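(* Let $\Sigma(x)$ be one of the functions $\sin x$, $\sinh x$, or $1$, let $X(u,v)$ and $Z(u,v)$ be smooth real-valued functions, and consider the (surface homogeneous) metric $$ds^2 = e^{2X(u,v)}\Bigl(2e^{2Z(u,v)}\,du\,dv - \bigl(dx^2+\Sigma^2(x)\,dy^2\bigr)\Bigr)$$ in coordinates $(u,v,x,y)$, on a coordinate domain where $\Sigma(x)\neq 0$. Suppose that this metric is of Petrov type D. Let $Y^1(u)$ and $Y^2(v)$ be smooth real-valued functions of one variable, let $\mathcal{C}$ be a real constant, and set $$\xi^a = Y^1(u)\,\partial_u + Y^2(v)\,\partial_v + \mathcal{C}\,(x\,\partial_x + y\,\partial_y).$$ Then $\xi^a$ is a conformal vector of the metric if and only if the equation $$2\mathcal{C} = Y^1_{,u} + 2Y^1 Z_{,u} + Y^2_{,v} + 2Y^2 Z_{,v}$$ is satisfied and, in the non-plane symmetric cases $\Sigma(x)=\sin x$ and $\Sigma(x)=\sinh x$, $\mathcal{C}=0$. In that case the divergence $\psi$ of $\xi^a$ is $$\psi = \mathcal{C} + \xi^a X_{,a} = (X+Z)_{,a}\,\xi^a + \tfrac12\bigl(Y^1_{,u}+Y^2_{,v}\bigr).$$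
   Context: A conformal vector of a metric $g_{ab}$ with Levi-Civita derivative denoted by a semicolon is a vector field $\xi^a$ satisfying $\xi_{a;b} = F_{ab} + \psi g_{ab}$ with $F_{ab}$ antisymmetric and $\psi$ a (not necessarily constant) scalar function; equivalently $\mathcal{L}_\xi g_{ab} = 2\psi g_{ab}$. The scalar $\psi$ is called the divergence of $\xi^a$. Commas denote partial derivatives. The signature is $(+,-,-,-)$. The case $\Sigma(x)=\sin x$ is called spherically symmetric, $\Sigma(x)=\sinh x$ pseudo-spherical, and $\Sigma(x)=1$ plane symmetric. Metrics of this form have Weyl tensor of Petrov type D or O (conformally flat) at each point, so the type D hypothesis means that the Weyl tensor is non-zero. *)

theory Defs
  imports "HOL-Analysis.Analysis"
begin

text \<open>
  \<open>Ck_on k S f\<close> is meant for open \<open>S\<close>: all iterated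
  partial derivatives up to order \<open>k\<close> exist and are continuous on \<open>S\<close>.
\<close>

primrec Ck_on :: "nat \<Rightarrow> 'a::euclidean_space set \<Rightarrow> ('a \<Rightarrow> real) \<Rightarrow> bool" where
  "Ck_on 0 S f \<longleftrightarrow> continuous_on S f"
| "Ck_on (Suc k) S f \<longleftrightarrow>
     f differentiable_on S \<and> (\<forall>b\<in>Basis. Ck_on k S (\<lambda>x. frechet_derivative f (at x) b))"

definition smooth_on :: "'a::euclidean_space set \<Rightarrow> ('a \<Rightarrow> real) \<Rightarrow> bool" where
  "smooth_on S f \<longleftrightarrow> (\<forall>k. Ck_on k S f)"

text \<open>
  A chart is a subset of \<open>real ^ 'n\<close>; tensor fields are given by their coordinate components.
\<close>

definition coord_deriv :: "'n::finite \<Rightarrow> (real ^ 'n \<Rightarrow> real) \<Rightarrow> real ^ 'n \<Rightarrow> real" where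
  "coord_deriv i f p = deriv (\<lambda>t. f (p + t *\<^sub>R axis i 1)) 0"

type_synonym 'n metric_field = "real ^ 'n \<Rightarrow> real ^ 'n ^ 'n"

text \<open>\<open>christoffel g a b c\<close> is \<open>\<Gamma>\<close> with upper index \<open>a\<close> and lower indices \<open>b, c\<close>.\<close>

definition christoffel :: "'n::finite metric_field \<Rightarrow> 'n \<Rightarrow> 'n \<Rightarrow> 'n \<Rightarrow> real ^ 'n \<Rightarrow> real" where
  "christoffel g a b c p =
     (1/2) * (\<Sum>d\<in>UNIV. matrix_inv (g p) $ a $ d *
        (coord_deriv b (\<lambda>q. g q $ d $ c) p
         + coord_deriv c (\<lambda>q. g q $ d $ b) p
         - coord_deriv d (\<lambda>q. g q $ b $ c) p))"

text \<open>\<open>riemann_up g a b c d\<close> is the curvature tensor with upper index \<open>a\<close> and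
  lower indices \<open>b, c, d\<close>, antisymmetric in \<open>c, d\<close>; the Ricci tensor contracts \<open>a\<close> with \<open>c\<close>.\<close>

definition riemann_up ::
    "'n::finite metric_field \<Rightarrow> 'n \<Rightarrow> 'n \<Rightarrow> 'n \<Rightarrow> 'n \<Rightarrow> real ^ 'n \<Rightarrow> real" where
  "riemann_up g a b c d p =
     coord_deriv c (christoffel g a d b) p - coord_deriv d (christoffel g a c b) p
     + (\<Sum>e\<in>UNIV. christoffel g a c e p * christoffel g e d b p
                - christoffel g a d e p * christoffel g e c b p)"

definition riemann ::
    "'n::finite metric_field \<Rightarrow> 'n \<Rightarrow> 'n \<Rightarrow> 'n \<Rightarrow> 'n \<Rightarrow> real ^ 'n \<Rightarrow> real" where
  "riemann g a b c d p = (\<Sum>e\<in>UNIV. g p $ a $ e * riemann_up g e b c d p)"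

definition ricci :: "'n::finite metric_field \<Rightarrow> 'n \<Rightarrow> 'n \<Rightarrow> real ^ 'n \<Rightarrow> real" where
  "ricci g b d p = (\<Sum>a\<in>UNIV. riemann_up g a b a d p)"

definition scalar_curvature :: "'n::finite metric_field \<Rightarrow> real ^ 'n \<Rightarrow> real" where
  "scalar_curvature g p =
     (\<Sum>b\<in>UNIV. \<Sum>d\<in>UNIV. matrix_inv (g p) $ b $ d * ricci g b d p)"

definition weyl ::
    "'n::finite metric_field \<Rightarrow> 'n \<Rightarrow> 'n \<Rightarrow> 'n \<Rightarrow> 'n \<Rightarrow> real ^ 'n \<Rightarrow> real" where
  "weyl g a b c d p =
     (let n = real CARD('n); G = g p in
        riemann g a b c d p
        - 1 / (n - 2) * (G $ a $ c * ricci g b d p - G $ a $ d * ricci g b c p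
                         + G $ b $ d * ricci g a c p - G $ b $ c * ricci g a d p)
        + scalar_curvature g p / ((n - 1) * (n - 2))
            * (G $ a $ c * G $ b $ d - G $ a $ d * G $ b $ c))"

definition null_vector :: "'n::finite metric_field \<Rightarrow> real ^ 'n \<Rightarrow> real ^ 'n \<Rightarrow> bool" where
  "null_vector g p k \<longleftrightarrow> k \<noteq> 0 \<and> k \<bullet> (g p *v k) = 0"

text \<open>
  Bel-Debever criterion for the null vector \<open>k\<close> to span a principal null direction of multiplicity
  at least two: \<open>k\<^sup>b k\<^sup>c C\<^bsub>abc[d\<^esub> k\<^bsub>e]\<^esub> = 0\<close>. Here \<open>g p *v k\<close> is \<open>k\<close> with its index lowered.
\<close>

definition repeated_principal_null_vector ::
    "4 metric_field \<Rightarrow> real ^ 4 \<Rightarrow> real ^ 4 \<Rightarrow> bool" where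
  "repeated_principal_null_vector g p k \<longleftrightarrow>
     null_vector g p k \<and>
     (\<forall>a d e. (\<Sum>b\<in>UNIV. \<Sum>c\<in>UNIV. k $ b * k $ c *
        (weyl g a b c d p * (g p *v k) $ e - weyl g a b c e p * (g p *v k) $ d)) = 0)"

text \<open>
  A non-zero Weyl tensor has four principal
  null directions counted with multiplicity, so the two directions below have multiplicity
  exactly two and there are no others.
\<close>

definition petrov_type_D :: "4 metric_field \<Rightarrow> real ^ 4 \<Rightarrow> bool" where
  "petrov_type_D g p \<longleftrightarrow>
     (\<exists>a b c d. weyl g a b c d p \<noteq> 0) \<and>
     (\<exists>k l. repeated_principal_null_vector g p k \<and> repeated_principal_null_vector g p l \<and>
        \<not> (\<exists>r. l = r *\<^sub>R k))"

text \<open>\<open>cov_deriv g \<xi> a b\<close> is \<open>\<xi>\<^bsub>a;b\<^esub>\<close>, where the components of \<open>\<xi>\<close> itself are contravariant.\<close>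

definition cov_deriv ::
    "'n::finite metric_field \<Rightarrow> (real ^ 'n \<Rightarrow> real ^ 'n) \<Rightarrow> 'n \<Rightarrow> 'n \<Rightarrow> real ^ 'n \<Rightarrow> real" where
  "cov_deriv g \<xi> a b p =
     coord_deriv b (\<lambda>q. (g q *v \<xi> q) $ a) p
     - (\<Sum>c\<in>UNIV. christoffel g c a b p * (g p *v \<xi> p) $ c)"

definition conformal_vector_with_divergence ::
    "(real ^ 'n) set \<Rightarrow> 'n::finite metric_field \<Rightarrow> (real ^ 'n \<Rightarrow> real ^ 'n)
       \<Rightarrow> (real ^ 'n \<Rightarrow> real) \<Rightarrow> bool" where
  "conformal_vector_with_divergence M g \<xi> \<psi> \<longleftrightarrow>
     (\<forall>a. smooth_on M (\<lambda>p. \<xi> p $ a)) \<and>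
     (\<exists>F :: real ^ 'n \<Rightarrow> real ^ 'n ^ 'n. \<forall>p\<in>M.
        (\<forall>a b. F p $ a $ b = - F p $ b $ a) \<and>
        (\<forall>a b. cov_deriv g \<xi> a b p = F p $ a $ b + \<psi> p * g p $ a $ b))"

definition conformal_vector ::
    "(real ^ 'n) set \<Rightarrow> 'n::finite metric_field \<Rightarrow> (real ^ 'n \<Rightarrow> real ^ 'n) \<Rightarrow> bool" where
  "conformal_vector M g \<xi> \<longleftrightarrow> (\<exists>\<psi>. conformal_vector_with_divergence M g \<xi> \<psi>)"

text \<open>
  The coordinates \<open>(u, v, x, y)\<close> of a point \<open>p\<close> are \<open>p $ 1, p $ 2, p $ 3, p $ 4\<close>.
\<close>

definition surface_metric ::
    "(real \<Rightarrow> real) \<Rightarrow> (real \<Rightarrow> real \<Rightarrow> real) \<Rightarrow> (real \<Rightarrow> real \<Rightarrow> real) \<Rightarrow> 4 metric_field" where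
  "surface_metric \<Sigma> X Z p =
     (let u = p $ 1; v = p $ 2; x = p $ 3 in
      exp (2 * X u v) *\<^sub>R
        vector [vector [0, exp (2 * Z u v), 0, 0],
                vector [exp (2 * Z u v), 0, 0, 0],
                vector [0, 0, -1, 0],
                vector [0, 0, 0, - (\<Sigma> x)\<^sup>2]])"

lemma vector_4_nth [simp]:
  "(vector [a, b, c, d] :: 'a::zero ^ 4) $ 1 = a"
  "(vector [a, b, c, d] :: 'a::zero ^ 4) $ 2 = b"
  "(vector [a, b, c, d] :: 'a::zero ^ 4) $ 3 = c"
  "(vector [a, b, c, d] :: 'a::zero ^ 4) $ 4 = d"
  unfolding vector_def by simp_all

lemma surface_metric_line_element:
  fixes w :: "real ^ 4"
  shows "w \<bullet> (surface_metric \<Sigma> X Z p *v w) =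
    exp (2 * X (p $ 1) (p $ 2)) *
      (2 * exp (2 * Z (p $ 1) (p $ 2)) * w $ 1 * w $ 2
       - ((w $ 3)\<^sup>2 + (\<Sigma> (p $ 3))\<^sup>2 * (w $ 4)\<^sup>2))"
  by (simp add: surface_metric_def Let_def inner_vec_def matrix_vector_mult_def sum_4
      algebra_simps power2_eq_square)

definition surface_vector ::
    "(real \<Rightarrow> real) \<Rightarrow> (real \<Rightarrow> real) \<Rightarrow> real \<Rightarrow> real ^ 4 \<Rightarrow> real ^ 4" where
  "surface_vector Y1 Y2 C p = vector [Y1 (p $ 1), Y2 (p $ 2), C * p $ 3, C * p $ 4]"

end

theory Submission
  imports Defs
begin

text \<open>
  The symmetric part of \<open>\<xi>\<^bsub>a;b\<^esub>\<close> is half the Lie derivative of the metric, so \<open>\<xi>\<close> is conformal iff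
  that Lie derivative is \<open>2 \<psi> g\<close>. For the vector at hand it is diagonal in the blocks \<open>uv\<close>, \<open>xx\<close>,
  \<open>yy\<close>: the \<open>xx\<close> component determines \<open>\<psi>\<close>, the \<open>uv\<close> component then gives the differential equation,
  and the \<open>yy\<close> component leaves \<open>C x \<Sigma>'(x) = 0\<close>.
\<close>

section \<open>Calculus of coordinate derivatives\<close>

lemma coord_derivI:
  assumes "((\<lambda>t. f (p + t *\<^sub>R axis i 1)) has_real_derivative D) (at 0)"
  shows "coord_deriv i f p = D"
  using assms unfolding coord_deriv_def by (rule DERIV_imp_deriv)

text \<open>Chain rule along the line through \<open>p\<close> in direction \<open>i\<close>. Since
  \<open>deriv\<close> is a choice operator, its value carries information only once some derivative
  exists; this lemma supplies that existence to the calculus rules below.\<close>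

lemma differentiable_has_coord_deriv:
  assumes "f differentiable (at p)"
  shows "((\<lambda>t. f (p + t *\<^sub>R axis i 1)) has_real_derivative coord_deriv i f p) (at 0)"
proof -
  obtain f' where f': "(f has_derivative f') (at p)"
    using assms unfolding differentiable_def by blast
  have "((\<lambda>t. f (p + t *\<^sub>R axis i 1)) has_derivative (\<lambda>t. f' (t *\<^sub>R axis i 1))) (at 0)"
    by (rule has_derivative_compose[where f = "\<lambda>t. p + t *\<^sub>R axis i 1" and g = f])
      (auto intro!: derivative_eq_intros simp: f')
  then have "(\<lambda>t. f (p + t *\<^sub>R axis i 1)) differentiable (at 0)"
    unfolding differentiable_def by blast
  then show ?thesis
    unfolding coord_deriv_def using DERIV_deriv_iff_real_differentiable by blast
qed

lemma coord_deriv_const [simp]: "coord_deriv i (\<lambda>q. c) p = 0"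
  by (rule coord_derivI) simp

lemma coord_deriv_add:
  assumes "f differentiable (at p)" "h differentiable (at p)"
  shows "coord_deriv i (\<lambda>q. f q + h q) p = coord_deriv i f p + coord_deriv i h p"
  by (rule coord_derivI) (intro DERIV_add differentiable_has_coord_deriv assms)

lemma coord_deriv_mult:
  assumes "f differentiable (at p)" "h differentiable (at p)"
  shows "coord_deriv i (\<lambda>q. f q * h q) p = coord_deriv i f p * h p + f p * coord_deriv i h p"
  by (rule coord_derivI)
    (use DERIV_mult[OF differentiable_has_coord_deriv[OF assms(1)]
        differentiable_has_coord_deriv[OF assms(2)]] in \<open>simp add: algebra_simps\<close>)

lemma coord_deriv_sum:
  assumes "\<And>k. k \<in> K \<Longrightarrow> f k differentiable (at p)"
  shows "coord_deriv i (\<lambda>q. \<Sum>k\<in>K. f k q) p = (\<Sum>k\<in>K. coord_deriv i (f k) p)"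
  by (rule coord_derivI) (intro DERIV_sum differentiable_has_coord_deriv assms)

lemma coord_deriv_compose:
  assumes "f differentiable (at p)" "(h has_real_derivative D) (at (f p))"
  shows "coord_deriv i (\<lambda>q. h (f q)) p = D * coord_deriv i f p"
  by (rule coord_derivI)
    (use DERIV_chain2[OF _ differentiable_has_coord_deriv[OF assms(1)], of h D] assms(2)
      in simp)

lemma coord_deriv_nth: "coord_deriv i (\<lambda>q. q $ j) p = (if i = j then 1 else 0)"
  by (rule coord_derivI) (auto simp: axis_def intro!: derivative_eq_intros)

lemma differentiable_nth: "(\<lambda>q :: real ^ 'n. q $ j) differentiable (at p)"
  by (intro bounded_linear_imp_differentiable bounded_linear_vec_nth)

lemma differentiable_compose_nth:
  fixes f :: "real \<Rightarrow> real" and p :: "real ^ 'n"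
  assumes "f differentiable (at (p $ i))"
  shows "(\<lambda>q. f (q $ i)) differentiable (at p)"
  by (rule differentiable_compose[OF _ differentiable_nth]) (rule assms)

section \<open>The Lie derivative of a metric and the conformal condition\<close>

text \<open>Written with partial derivatives of \<open>g\<close> and of the contravariant components
  only, so evaluating it on an explicit metric requires neither the inverse metric nor Christoffel
  symbols.\<close>

definition lie_metric ::
    "'n::finite metric_field \<Rightarrow> (real ^ 'n \<Rightarrow> real ^ 'n) \<Rightarrow> 'n \<Rightarrow> 'n \<Rightarrow> real ^ 'n \<Rightarrow> real" where
  "lie_metric g \<xi> a b p =
     (\<Sum>c\<in>UNIV. \<xi> p $ c * coord_deriv c (\<lambda>q. g q $ a $ b) p
        + g p $ c $ b * coord_deriv a (\<lambda>q. \<xi> q $ c) p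
        + g p $ a $ c * coord_deriv b (\<lambda>q. \<xi> q $ c) p)"

lemma matrix_inv_right:
  assumes "invertible A"
  shows "A ** matrix_inv A = mat 1"
  using someI_ex[OF assms[unfolded invertible_def]] by (simp add: matrix_inv_def)

text \<open>Lowering the upper index cancels the inverse metric and leaves Christoffel symbols of
  the first kind. Symmetry of \<open>g p\<close> allows it to be moved across the inner product onto
  its inverse.\<close>

lemma christoffel_lowered:
  assumes sym: "transpose (g p) = g p" and inv: "invertible (g p)"
  shows "(\<Sum>c\<in>UNIV. christoffel g c a b p * (g p *v w) $ c) =
    1/2 * (\<Sum>d\<in>UNIV. w $ d * (coord_deriv a (\<lambda>q. g q $ d $ b) p
      + coord_deriv b (\<lambda>q. g q $ d $ a) p - coord_deriv d (\<lambda>q. g q $ a $ b) p))"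
proof -
  \<comment> \<open>Twice the Christoffel symbol of the first kind, as a vector in its free index
    \<open>d\<close>; the sum in \<open>christoffel\<close> becomes a matrix-vector product.\<close>
  define S where "S = (\<chi> d. coord_deriv a (\<lambda>q. g q $ d $ b) p
      + coord_deriv b (\<lambda>q. g q $ d $ a) p - coord_deriv d (\<lambda>q. g q $ a $ b) p)"
  have chr: "christoffel g c a b p = 1/2 * (matrix_inv (g p) *v S) $ c" for c
    by (simp add: christoffel_def S_def matrix_vector_mult_def)
  have "(\<Sum>c\<in>UNIV. christoffel g c a b p * (g p *v w) $ c)
      = 1/2 * ((matrix_inv (g p) *v S) \<bullet> (g p *v w))"
    by (simp add: chr inner_vec_def sum_distrib_left mult.assoc)
  also have "(matrix_inv (g p) *v S) \<bullet> (g p *v w) = (g p *v (matrix_inv (g p) *v S)) \<bullet> w"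
    by (metis dot_lmul_matrix sym transpose_matrix_vector)
  also have "g p *v (matrix_inv (g p) *v S) = S"
    by (simp add: matrix_vector_mul_assoc matrix_inv_right[OF inv])
  finally show ?thesis
    by (simp add: S_def inner_vec_def mult.commute)
qed

text \<open>The product rule applied to the lowered components produces derivatives of
  \<open>g\<close> in directions \<open>a\<close> and \<open>b\<close>. These cancel against the
  Christoffel terms, and only the derivative of \<open>g\<close> along \<open>\<xi>\<close> and the
  derivatives of \<open>\<xi>\<close> survive.\<close>

lemma cov_deriv_symmetrized:
  fixes g :: "'n::finite metric_field"
  assumes sym: "\<And>q. transpose (g q) = g q" and inv: "invertible (g p)"
    and dg: "\<And>a b. (\<lambda>q. g q $ a $ b) differentiable (at p)"
    and dxi: "\<And>a. (\<lambda>q. \<xi> q $ a) differentiable (at p)"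
  shows "cov_deriv g \<xi> a b p + cov_deriv g \<xi> b a p = lie_metric g \<xi> a b p"
proof -
  have comm: "g q $ a $ b = g q $ b $ a" for q a b
    using arg_cong[OF sym[of q], of "\<lambda>A. A $ a $ b"] by (simp add: transpose_def)
  have low: "coord_deriv b (\<lambda>q. (g q *v \<xi> q) $ a) p =
      (\<Sum>c\<in>UNIV. coord_deriv b (\<lambda>q. g q $ a $ c) p * \<xi> p $ c
        + g p $ a $ c * coord_deriv b (\<lambda>q. \<xi> q $ c) p)" for a b
    by (simp add: matrix_vector_mult_def coord_deriv_sum coord_deriv_mult dg dxi
        differentiable_mult)
  show ?thesis
    unfolding cov_deriv_def low christoffel_lowered[where g = g and p = p, OF sym inv] lie_metric_def
      sum_distrib_left sum.distrib[symmetric] sum_subtractf[symmetric]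
    by (rule sum.cong[OF refl], subst (1 2) comm[of _ b], subst (1 2) comm[of _ _ a])
      (simp add: comm[of _ b a] field_simps)
qed

text \<open>Symmetrizing removes the antisymmetric \<open>F\<close> and doubles the multiple of
  \<open>g\<close>, so only the Lie derivative is constrained.\<close>

lemma conformal_vector_with_divergence_iff_lie:
  fixes g :: "'n::finite metric_field"
  assumes sym: "\<And>q. transpose (g q) = g q" and inv: "\<And>p. p \<in> M \<Longrightarrow> invertible (g p)"
    and dg: "\<And>p a b. p \<in> M \<Longrightarrow> (\<lambda>q. g q $ a $ b) differentiable (at p)"
    and dxi: "\<And>p a. p \<in> M \<Longrightarrow> (\<lambda>q. \<xi> q $ a) differentiable (at p)"
    and smooth: "\<And>a. smooth_on M (\<lambda>p. \<xi> p $ a)"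
  shows "conformal_vector_with_divergence M g \<xi> \<psi> \<longleftrightarrow>
    (\<forall>p\<in>M. \<forall>a b. lie_metric g \<xi> a b p = 2 * \<psi> p * g p $ a $ b)"
    (is "?L \<longleftrightarrow> ?R")
proof -
  have comm: "g q $ a $ b = g q $ b $ a" for q a b
    using arg_cong[OF sym[of q], of "\<lambda>A. A $ a $ b"] by (simp add: transpose_def)
  have lie: "lie_metric g \<xi> a b p = cov_deriv g \<xi> a b p + cov_deriv g \<xi> b a p"
    if "p \<in> M" for p a b
    using cov_deriv_symmetrized[OF sym inv[OF that] dg[OF that] dxi[OF that]] by simp
  show ?thesis
  proof
    assume ?L
    then obtain F where F: "\<And>p a b. p \<in> M \<Longrightarrow> F p $ a $ b = - F p $ b $ a"
        "\<And>p a b. p \<in> M \<Longrightarrow> cov_deriv g \<xi> a b p = F p $ a $ b + \<psi> p * g p $ a $ b"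
      unfolding conformal_vector_with_divergence_def by blast
    show ?R
    proof (intro ballI allI)
      fix p a b assume p: "p \<in> M"
      show "lie_metric g \<xi> a b p = 2 * \<psi> p * g p $ a $ b"
        using F(1)[OF p, of a b] by (simp add: lie[OF p] F(2)[OF p] comm[of p b a])
    qed
  next
    assume R: ?R
    \<comment> \<open>The antisymmetric part of the covariant derivative; what remains is half the
      Lie derivative, which is \<open>\<psi> p * g p\<close> by assumption.\<close>
    let ?F = "\<lambda>p. (\<chi> a b. (cov_deriv g \<xi> a b p - cov_deriv g \<xi> b a p) / 2) :: real ^ 'n ^ 'n"
    have F: "cov_deriv g \<xi> a b p = ?F p $ a $ b + \<psi> p * g p $ a $ b" if "p \<in> M" for p a b
      using R[rule_format, OF that, of a b] by (simp add: lie[OF that] field_simps)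
    then show ?L
      unfolding conformal_vector_with_divergence_def
    proof (intro conjI exI[of _ ?F] ballI allI smooth F)
      show "?F p $ a $ b = - ?F p $ b $ a" for p a b
        by (simp add: minus_divide_left)
    qed
  qed
qed

section \<open>Smoothness of the components of the vector field\<close>

lemma Ck_on_cong:
  assumes "open S" "\<And>x. x \<in> S \<Longrightarrow> f x = h x" "Ck_on k S f"
  shows "Ck_on k S h"
  using assms(2,3)
proof (induction k arbitrary: f h)
  case 0
  then show ?case by (simp cong: continuous_on_cong)
next
  case (Suc k)
  have "frechet_derivative f (at x) = frechet_derivative h (at x)" if "x \<in> S" for x
  proof -
    \<comment> \<open>\<open>frechet_derivative\<close> chooses some \<open>D\<close> with this
      property, so the two choices agree once the properties coincide for every
      \<open>D\<close>.\<close>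
    have "(f has_derivative D) (at x) \<longleftrightarrow> (h has_derivative D) (at x)" for D
      using has_derivative_transform_within_open[OF _ assms(1) that] Suc.prems(1) by metis
    then show ?thesis unfolding frechet_derivative_def by simp
  qed
  moreover have "h differentiable_on S"
    using Suc.prems by (simp add: differentiable_on_def)
      (metis (no_types, lifting) differentiable_transform_within zero_less_one)
  ultimately show ?case
    using Suc.prems(2) by (auto intro: Suc.IH[rotated])
qed

lemma Ck_on_const: "Ck_on k S (\<lambda>x. c)"
proof (induction k arbitrary: c)
  case (Suc k)
  then show ?case by (simp add: frechet_derivative_const)
qed simp

text \<open>The first derivative is constant, so a case distinction on the order replaces an
  induction. This serves the components \<open>C * x\<close> and \<open>C * y\<close>.\<close>

lemma smooth_on_scale: "smooth_on S (\<lambda>x :: real. c * x)"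
proof -
  have "frechet_derivative (\<lambda>x. c * x) (at x) = (*) c" for x :: real
    by (intro frechet_derivative_at[symmetric]) (auto intro!: derivative_eq_intros)
  then have "Ck_on k S (\<lambda>x :: real. c * x)" for k
    by (cases k) (auto simp: Ck_on_const intro!: continuous_intros derivative_intros)
  then show ?thesis by (simp add: smooth_on_def)
qed

text \<open>By the chain rule the derivative in a basis direction \<open>b\<close> is that of
  \<open>f\<close> in direction \<open>b $ i\<close>. This number is 0 or 1, so the derivative is
  either zero or again a function of the \<open>i\<close>-th coordinate, to which the induction
  hypothesis applies.\<close>

lemma Ck_on_compose_nth:
  fixes M :: "(real ^ 'n) set"
  assumes "open M" "open S" "\<And>p. p \<in> M \<Longrightarrow> p $ i \<in> S" "Ck_on k S f"
  shows "Ck_on k M (\<lambda>p. f (p $ i))"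
  using assms(4)
proof (induction k arbitrary: f)
  case 0
  then show ?case
    using assms(3) by (auto intro!: continuous_on_compose2[of S f] continuous_intros)
next
  case (Suc k)
  have fd: "f differentiable (at (p $ i))" if "p \<in> M" for p
    using Suc.prems assms that by (simp add: differentiable_on_eq_differentiable_at)
  have fr: "frechet_derivative (\<lambda>p. f (p $ i)) (at p) b
      = frechet_derivative f (at (p $ i)) (b $ i)" if "p \<in> M" for p b
  proof -
    have "((\<lambda>p. f (p $ i)) has_derivative (\<lambda>b. frechet_derivative f (at (p $ i)) (b $ i))) (at p)"
      by (rule has_derivative_compose[where f = "\<lambda>p. p $ i" and g = f])
        (use frechet_derivative_works[THEN iffD1, OF fd[OF that]] in
          \<open>auto intro!: bounded_linear_imp_has_derivative bounded_linear_vec_nth\<close>)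
    then show ?thesis by (simp add: frechet_derivative_at[symmetric])
  qed
  have "Ck_on k M (\<lambda>p. frechet_derivative (\<lambda>p. f (p $ i)) (at p) b)" if b: "b \<in> Basis" for b
  proof (rule Ck_on_cong[OF assms(1)])
    show "frechet_derivative f (at (p $ i)) (b $ i) = frechet_derivative (\<lambda>p. f (p $ i)) (at p) b"
      if "p \<in> M" for p using fr[OF that] by simp
    obtain j where "b = axis j 1" using b by (auto simp: Basis_vec_def)
    then have "b $ i = 0 \<or> b $ i = 1" by (simp add: axis_def)
    then show "Ck_on k M (\<lambda>p. frechet_derivative f (at (p $ i)) (b $ i))"
    proof
      assume "b $ i = 0"
      have "frechet_derivative f (at (p $ i)) 0 = 0" if "p \<in> M" for p
        using fd[OF that] linear_0 linear_frechet_derivative by blast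
      with \<open>b $ i = 0\<close> show ?thesis
        by (intro Ck_on_cong[OF assms(1) _ Ck_on_const[of k M 0]]) simp
    next
      assume "b $ i = 1"
      then show ?thesis
        using Suc.prems Suc.IH[of "\<lambda>x. frechet_derivative f (at x) 1"] by simp
    qed
  qed
  moreover have "(\<lambda>p. f (p $ i)) differentiable_on M"
    using fd by (intro differentiable_at_imp_differentiable_on differentiable_compose_nth)
  ultimately show ?case by simp
qed

lemma smooth_on_compose_nth:
  fixes M :: "(real ^ 'n) set"
  assumes "open M" "open S" "\<And>p. p \<in> M \<Longrightarrow> p $ i \<in> S" "smooth_on S f"
  shows "smooth_on M (\<lambda>p. f (p $ i))"
  using Ck_on_compose_nth[OF assms(1-3)] assms(4) by (simp add: smooth_on_def)

lemma smooth_on_imp_differentiable: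
  assumes "smooth_on S f" "open S" "x \<in> S"
  shows "f differentiable (at x)"
proof -
  have "Ck_on (Suc 0) S f" using assms(1) unfolding smooth_on_def by blast
  then show ?thesis using assms by (simp add: differentiable_on_eq_differentiable_at)
qed

section \<open>Derivatives of the functions occurring in the metric\<close>

lemma differentiable_exp_double:
  fixes f :: "'a::real_normed_vector \<Rightarrow> real"
  assumes "f differentiable (at p)"
  shows "(\<lambda>q. exp (2 * f q)) differentiable (at p)"
  using assms by (intro differentiable_compose[of exp "\<lambda>q. 2 * f q"])
    (auto intro!: derivative_intros field_differentiable_imp_differentiable
      simp: field_differentiable_within_exp)

lemma coord_deriv_exp:
  assumes "f differentiable (at p)"
  shows "coord_deriv i (\<lambda>q. exp (2 * f q)) p = 2 * exp (2 * f p) * coord_deriv i f p"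
  by (rule coord_deriv_compose[OF assms]) (auto intro!: derivative_eq_intros)

lemma coord_deriv_compose_nth:
  fixes f :: "real \<Rightarrow> real" and p :: "real ^ 'n"
  assumes "f differentiable (at (p $ j))"
  shows "coord_deriv i (\<lambda>q. f (q $ j)) p = (if i = j then deriv f (p $ j) else 0)"
  using coord_deriv_compose[OF differentiable_nth, of f "deriv f (p $ j)" p j i] assms
  by (simp add: coord_deriv_nth DERIV_deriv_iff_real_differentiable)

lemma deriv_shift: "deriv (\<lambda>t. f (a + t)) 0 = deriv f (a :: real)"
  using DERIV_shift[of f _ 0 a] by (simp add: deriv_def add.commute)

text \<open>Links chart derivatives to the one-variable derivatives in the theorem. Both sides are
  the same \<open>deriv\<close> up to a shift of the variable, hence equal even where no derivative
  exists.\<close>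

lemma coord_deriv_uv:
  fixes p :: "real ^ 4" and f :: "real \<Rightarrow> real \<Rightarrow> real"
  shows "coord_deriv 1 (\<lambda>q. f (q $ 1) (q $ 2)) p = deriv (\<lambda>u. f u (p $ 2)) (p $ 1)"
    and "coord_deriv 2 (\<lambda>q. f (q $ 1) (q $ 2)) p = deriv (\<lambda>v. f (p $ 1) v) (p $ 2)"
    and "coord_deriv 3 (\<lambda>q. f (q $ 1) (q $ 2)) p = 0"
    and "coord_deriv 4 (\<lambda>q. f (q $ 1) (q $ 2)) p = 0"
  using deriv_shift[of "\<lambda>u. f u (p $ 2)" "p $ 1"] deriv_shift[of "\<lambda>v. f (p $ 1) v" "p $ 2"]
  by (simp_all add: coord_deriv_def axis_def)

section \<open>The surface metric and its Lie derivative\<close>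

lemma surface_metric_nth:
  "surface_metric \<Sigma> X Z p =
    vector [vector [0, exp (2 * X (p $ 1) (p $ 2)) * exp (2 * Z (p $ 1) (p $ 2)), 0, 0],
            vector [exp (2 * X (p $ 1) (p $ 2)) * exp (2 * Z (p $ 1) (p $ 2)), 0, 0, 0],
            vector [0, 0, - exp (2 * X (p $ 1) (p $ 2)), 0],
            vector [0, 0, 0, - (exp (2 * X (p $ 1) (p $ 2)) * (\<Sigma> (p $ 3))\<^sup>2)]]"
  by (simp add: surface_metric_def Let_def vec_eq_iff forall_4)

lemma transpose_surface_metric: "transpose (surface_metric \<Sigma> X Z p) = surface_metric \<Sigma> X Z p"
  by (simp add: transpose_def surface_metric_nth vec_eq_iff forall_4)

lemma invertible_surface_metric:
  assumes "\<Sigma> (p $ 3) \<noteq> 0"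
  shows "invertible (surface_metric \<Sigma> X Z p)"
proof -
  let ?e = "exp (2 * X (p $ 1) (p $ 2)) * exp (2 * Z (p $ 1) (p $ 2))"
  \<comment> \<open>The blockwise inverse; the last entry uses that \<open>\<Sigma>\<close> does not
    vanish. For square matrices a right inverse suffices.\<close>
  let ?B = "vector [vector [0, inverse ?e, 0, 0], vector [inverse ?e, 0, 0, 0],
            vector [0, 0, - inverse (exp (2 * X (p $ 1) (p $ 2))), 0],
            vector [0, 0, 0, - inverse (exp (2 * X (p $ 1) (p $ 2)) * (\<Sigma> (p $ 3))\<^sup>2)]] :: real ^ 4 ^ 4"
  have "surface_metric \<Sigma> X Z p ** ?B = mat 1"
    using assms
    by (simp add: matrix_matrix_mult_def mat_def surface_metric_nth vec_eq_iff forall_4 sum_4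
        field_simps)
  then show ?thesis
    using invertible_right_inverse by blast
qed

lemma differentiable_surface_metric:
  assumes X: "(\<lambda>q :: real ^ 4. X (q $ 1) (q $ 2)) differentiable (at p)"
    and Z: "(\<lambda>q :: real ^ 4. Z (q $ 1) (q $ 2)) differentiable (at p)"
    and S: "\<Sigma> differentiable (at (p $ 3))"
  shows "(\<lambda>q. surface_metric \<Sigma> X Z q $ a $ b) differentiable (at p)"
proof -
  note [derivative_intros] = differentiable_exp_double[OF X] differentiable_exp_double[OF Z] differentiable_compose_nth[OF S]
  \<comment> \<open>Quantifying over both indices lets \<open>forall_4\<close> split the claim into
    the sixteen entries.\<close>
  have "\<forall>a b. (\<lambda>q. surface_metric \<Sigma> X Z q $ a $ b) differentiable (at p)"
    by (auto simp: surface_metric_nth forall_4 intro!: derivative_intros)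
  then show ?thesis by blast
qed

text \<open>\<open>LX\<close> and \<open>LZ\<close> are the derivatives of \<open>X\<close> and
  \<open>Z\<close> along the vector field. Each nonzero entry of the Lie derivative is proportional
  to the corresponding metric entry, so the tensor equation at \<open>p\<close> becomes three scalar
  equations.\<close>

lemma lie_metric_surface:
  fixes p :: "real ^ 4" and \<Sigma> Y1 Y2 :: "real \<Rightarrow> real" and X Z :: "real \<Rightarrow> real \<Rightarrow> real" and C :: real
  defines "LX \<equiv> \<Sum>c\<in>UNIV. surface_vector Y1 Y2 C p $ c * coord_deriv c (\<lambda>q. X (q $ 1) (q $ 2)) p"
    and "LZ \<equiv> \<Sum>c\<in>UNIV. surface_vector Y1 Y2 C p $ c * coord_deriv c (\<lambda>q. Z (q $ 1) (q $ 2)) p"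
  assumes X: "(\<lambda>q :: real ^ 4. X (q $ 1) (q $ 2)) differentiable (at p)"
    and Z: "(\<lambda>q :: real ^ 4. Z (q $ 1) (q $ 2)) differentiable (at p)"
    and S: "\<Sigma> differentiable (at (p $ 3))"
    and Y: "Y1 differentiable (at (p $ 1))" "Y2 differentiable (at (p $ 2))"
    and nz: "\<Sigma> (p $ 3) \<noteq> 0"
  shows "(\<forall>a b. lie_metric (surface_metric \<Sigma> X Z) (surface_vector Y1 Y2 C) a b p
        = 2 * \<psi> * surface_metric \<Sigma> X Z p $ a $ b) \<longleftrightarrow>
    \<psi> = C + LX \<and> 2 * C = deriv Y1 (p $ 1) + deriv Y2 (p $ 2) + 2 * LZ
      \<and> C * p $ 3 * deriv \<Sigma> (p $ 3) = 0"
proof -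
  let ?eX = "exp (2 * X (p $ 1) (p $ 2))" and ?eZ = "exp (2 * Z (p $ 1) (p $ 2))"
  let ?g = "surface_metric \<Sigma> X Z" and ?\<xi> = "surface_vector Y1 Y2 C"
  let ?Xd = "\<lambda>c. coord_deriv c (\<lambda>q. X (q $ 1) (q $ 2)) p"
  let ?Zd = "\<lambda>c. coord_deriv c (\<lambda>q. Z (q $ 1) (q $ 2)) p"
  have S2: "(\<lambda>q. (\<Sigma> (q $ 3))\<^sup>2) differentiable (at p)"
    by (intro differentiable_power differentiable_compose_nth S)
  have d12: "coord_deriv c (\<lambda>q. exp (2 * X (q $ 1) (q $ 2)) * exp (2 * Z (q $ 1) (q $ 2))) p
      = 2 * (?Xd c + ?Zd c) * (?eX * ?eZ)" for c
    by (simp add: coord_deriv_mult coord_deriv_exp differentiable_exp_double X Z algebra_simps)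
  have minus: "coord_deriv c (\<lambda>q. - f q) p = - coord_deriv c f p"
    if "f differentiable (at p)" for c and f :: "real ^ 4 \<Rightarrow> real"
    using coord_deriv_compose[OF that, of uminus "-1"] DERIV_minus[OF DERIV_ident] by auto
  have d33: "coord_deriv c (\<lambda>q. - exp (2 * X (q $ 1) (q $ 2))) p = - 2 * ?Xd c * ?eX" for c
    by (simp add: minus coord_deriv_exp differentiable_exp_double X)
  have dS: "coord_deriv c (\<lambda>q. (\<Sigma> (q $ 3))\<^sup>2) p
      = (if c = 3 then 2 * \<Sigma> (p $ 3) * deriv \<Sigma> (p $ 3) else 0)" for c
    using S by (simp add: power2_eq_square coord_deriv_mult differentiable_compose_nth
        coord_deriv_compose_nth)
  have d44: "coord_deriv c (\<lambda>q. - (exp (2 * X (q $ 1) (q $ 2)) * (\<Sigma> (q $ 3))\<^sup>2)) p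
      = - 2 * ?Xd c * ?eX * (\<Sigma> (p $ 3))\<^sup>2
        - ?eX * (if c = 3 then 2 * \<Sigma> (p $ 3) * deriv \<Sigma> (p $ 3) else 0)" for c
    by (simp add: minus coord_deriv_mult coord_deriv_exp differentiable_exp_double X S2 dS)
  have dlin: "coord_deriv c (\<lambda>q :: real ^ 4. C * q $ j) p = (if c = j then C else 0)" for c j
    by (simp add: coord_deriv_mult differentiable_nth coord_deriv_nth)
  note d = d12 d33 d44 dlin coord_deriv_compose_nth[OF Y(1)] coord_deriv_compose_nth[OF Y(2)]
  \<comment> \<open>Each component of the vector depends on its own coordinate only, so no cross
    derivatives arise, and the metric entries at these places are zero.\<close>
  have off: "lie_metric ?g ?\<xi> a b p = 0"
    if "(a, b) \<notin> {(1, 2), (2, 1), (3, 3), (4, 4)}" for a b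
  proof -
    have "\<forall>a b. (a, b) \<notin> {(1, 2), (2, 1), (3, 3), (4, 4)} \<longrightarrow> lie_metric ?g ?\<xi> a b p = 0"
      by (simp add: forall_4 lie_metric_def sum_4 surface_metric_nth surface_vector_def d)
    with that show ?thesis by blast
  qed
  have l12: "lie_metric ?g ?\<xi> 1 2 p =
      ?eX * ?eZ * (2 * LX + 2 * LZ + deriv Y1 (p $ 1) + deriv Y2 (p $ 2))"
    by (simp add: lie_metric_def LX_def LZ_def sum_4 surface_metric_nth surface_vector_def d
        algebra_simps)
  have l21: "lie_metric ?g ?\<xi> 2 1 p = lie_metric ?g ?\<xi> 1 2 p"
    by (simp add: lie_metric_def sum_4 surface_metric_nth surface_vector_def d algebra_simps)
  have l33: "lie_metric ?g ?\<xi> 3 3 p = - ?eX * (2 * LX + 2 * C)"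
    by (simp add: lie_metric_def LX_def sum_4 surface_metric_nth surface_vector_def d
        algebra_simps)
  \<comment> \<open>Split so that the first summand matches the \<open>xx\<close> entry; the second
    comes from differentiating \<open>\<Sigma>\<close> squared along the \<open>x\<close>
    component.\<close>
  have l44: "lie_metric ?g ?\<xi> 4 4 p = - (?eX * (\<Sigma> (p $ 3))\<^sup>2) * (2 * LX + 2 * C)
      - ?eX * (2 * \<Sigma> (p $ 3)) * (C * p $ 3 * deriv \<Sigma> (p $ 3))"
    by (simp add: lie_metric_def LX_def sum_4 surface_metric_nth surface_vector_def d)
      (simp add: algebra_simps)
  have "(\<forall>a b. lie_metric ?g ?\<xi> a b p = 2 * \<psi> * ?g p $ a $ b) \<longleftrightarrow>
      lie_metric ?g ?\<xi> 1 2 p = ?eX * ?eZ * (2 * \<psi>) \<and>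
      lie_metric ?g ?\<xi> 3 3 p = - ?eX * (2 * \<psi>) \<and>
      lie_metric ?g ?\<xi> 4 4 p = - (?eX * (\<Sigma> (p $ 3))\<^sup>2) * (2 * \<psi>)"
    by (auto simp: forall_4 off surface_metric_nth l21 mult_ac)
  \<comment> \<open>The exponentials and, by \<open>nz\<close>, the factors of
    \<open>\<Sigma>\<close> cancel. Given the \<open>xx\<close> equation, the \<open>yy\<close>
    equation reduces to its last summand.\<close>
  also have "\<dots> \<longleftrightarrow> 2 * LX + 2 * LZ + deriv Y1 (p $ 1) + deriv Y2 (p $ 2) = 2 * \<psi> \<and>
      2 * LX + 2 * C = 2 * \<psi> \<and> C * p $ 3 * deriv \<Sigma> (p $ 3) = 0"
    unfolding l12 l33 l44 using nz by auto
  finally show ?thesis by auto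
qed

lemma smooth_surface_vector:
  fixes M :: "(real ^ 4) set"
  assumes "open M" "smooth_on ((\<lambda>p. p $ 1) ` M) Y1" "smooth_on ((\<lambda>p. p $ 2) ` M) Y2"
  shows "smooth_on M (\<lambda>p. surface_vector Y1 Y2 C p $ a)"
proof -
  have "\<forall>a. smooth_on M (\<lambda>p. surface_vector Y1 Y2 C p $ a)"
    using assms smooth_on_compose_nth[OF assms(1) open_UNIV _ smooth_on_scale[of UNIV C]]
    by (auto simp: forall_4 surface_vector_def open_image_vec_nth
        intro!: smooth_on_compose_nth[OF assms(1) open_image_vec_nth[OF assms(1)]])
  then show ?thesis by blast
qed

section \<open>Vanishing of the scaling constant in the curved cases\<close>

text \<open>Both \<open>sin\<close> and \<open>sinh\<close> vanish at 0, so \<open>x\<close> is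
  nonzero on \<open>M\<close> and \<open>C\<close> times the derivative of \<open>\<Sigma>\<close>
  must vanish. \<open>cosh\<close> has no zeros; for \<open>cos\<close> a second point of the open
  set may be required.\<close>

lemma scaling_coefficient_zero:
  fixes M :: "(real ^ 4) set"
  assumes M: "open M" "M \<noteq> {}" "\<And>p. p \<in> M \<Longrightarrow> \<Sigma> (p $ 3) \<noteq> 0"
    and Sigma_cases: "\<Sigma> = sin \<or> \<Sigma> = sinh"
    and zero: "\<And>p. p \<in> M \<Longrightarrow> C * p $ 3 * deriv \<Sigma> (p $ 3) = 0"
  shows "C = 0"
proof -
  obtain p where p: "p \<in> M" using M(2) by blast
  have nz: "q $ 3 \<noteq> 0" if "q \<in> M" for q
    using M(3)[OF that] Sigma_cases by auto
  have dsin: "deriv sin x = cos x" and dsinh: "deriv sinh x = cosh x" for x :: real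
    by (auto intro!: DERIV_imp_deriv derivative_eq_intros)
  show ?thesis
  proof (cases "\<Sigma> = sinh")
    case True
    then show ?thesis using zero[OF p] nz[OF p] by (simp add: dsinh)
  next
    case False
    with Sigma_cases have \<Sigma>: "\<Sigma> = sin" by blast
    have "open ((\<lambda>p. p $ 3) ` M)" using M(1) by (rule open_image_vec_nth)
    then obtain e where e: "e > 0" "ball (p $ 3) e \<subseteq> (\<lambda>p. p $ 3) ` M"
      using p by (meson image_eqI openE)
    (* cos may vanish at p, but not also at a small shift of p in the x direction *)
    define t where "t = min (e / 2) 1"
    have t: "0 < t" "t < e" "t < pi" using e(1) pi_gt3 by (auto simp: t_def)
    then have "p $ 3 + t \<in> ball (p $ 3) e" by (simp add: dist_real_def)
    with e(2) obtain q where q: "q \<in> M" "q $ 3 = p $ 3 + t" by force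
    \<comment> \<open>If the first cosine is zero, the addition formula leaves
      \<open>- sin (p $ 3) * sin t\<close>. This is nonzero because \<open>\<Sigma>\<close> does not
      vanish at \<open>p\<close> and \<open>t\<close> lies between 0 and \<open>pi\<close>.\<close>
    have "cos (p $ 3) \<noteq> 0 \<or> cos (q $ 3) \<noteq> 0"
      using sin_gt_zero[OF t(1,3)] M(3)[OF p] by (auto simp: q(2) cos_add \<Sigma>)
    then show ?thesis
      using zero[OF p] zero[OF q(1)] nz[OF p] nz[OF q(1)] by (auto simp: \<Sigma> dsin)
  qed
qed

section \<open>From conditions at each point to the equivalence on the domain\<close>

theorem theorem1:
  fixes \<Sigma> :: "real \<Rightarrow> real"
    and X Z :: "real \<Rightarrow> real \<Rightarrow> real"
    and Y1 Y2 :: "real \<Rightarrow> real"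
    and C :: real
    and M :: "(real ^ 4) set"
  defines "UV \<equiv> (\<lambda>p. (p $ 1, p $ 2)) ` M"
    and "g \<equiv> surface_metric \<Sigma> X Z"
    and "\<xi> \<equiv> surface_vector Y1 Y2 C"
  assumes domain: "open M" "M \<noteq> {}" "\<And>p. p \<in> M \<Longrightarrow> \<Sigma> (p $ 3) \<noteq> 0"
    and Sigma_cases: "\<Sigma> = sin \<or> \<Sigma> = sinh \<or> \<Sigma> = (\<lambda>x. 1)"
    and smooth_XZ: "smooth_on UV (\<lambda>(u, v). X u v)" "smooth_on UV (\<lambda>(u, v). Z u v)"
    and smooth_Y: "smooth_on (fst ` UV) Y1" "smooth_on (snd ` UV) Y2"
    and type_D: "\<And>p. p \<in> M \<Longrightarrow> petrov_type_D g p"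
  shows "(conformal_vector M g \<xi> \<longleftrightarrow>
            (\<forall>(u, v) \<in> UV.
               2 * C = deriv Y1 u + 2 * Y1 u * deriv (\<lambda>u'. Z u' v) u
                     + deriv Y2 v + 2 * Y2 v * deriv (\<lambda>v'. Z u v') v)
            \<and> (\<Sigma> = sin \<or> \<Sigma> = sinh \<longrightarrow> C = 0))
         \<and> (\<forall>\<psi>. conformal_vector_with_divergence M g \<xi> \<psi> \<longrightarrow>
              (\<forall>p\<in>M.
                 \<psi> p = C + (\<Sum>a\<in>UNIV. \<xi> p $ a * coord_deriv a (\<lambda>q. X (q $ 1) (q $ 2)) p) \<and>
                 \<psi> p = (\<Sum>a\<in>UNIV.
                          coord_deriv a (\<lambda>q. X (q $ 1) (q $ 2) + Z (q $ 1) (q $ 2)) p * \<xi> p $ a)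
                       + 1/2 * (deriv Y1 (p $ 1) + deriv Y2 (p $ 2))))"
proof -
  have UV: "open UV"
  proof -
    have "surj (\<lambda>p :: real ^ 4. (p $ 1, p $ 2))"
    proof (rule surjI)
      \<comment> \<open>Any lift of \<open>z\<close> will do, as only surjectivity of the linear
        projection is at stake; it makes the image of the open set \<open>M\<close> open.\<close>
      show "((vector [fst z, snd z, 0, 0] :: real ^ 4) $ 1,
          (vector [fst z, snd z, 0, 0] :: real ^ 4) $ 2) = z" for z :: "real \<times> real"
        by simp
    qed
    then show ?thesis
      unfolding UV_def
      by (intro open_surjective_linear_image domain(1)) (auto simp: linear_iff)
  qed
  have Ysets: "fst ` UV = (\<lambda>p. p $ 1) ` M" "snd ` UV = (\<lambda>p. p $ 2) ` M"
    by (auto simp: UV_def image_image)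
  have comp: "(\<lambda>q :: real ^ 4. f (q $ 1) (q $ 2)) differentiable (at p)"
    if "smooth_on UV (\<lambda>(u, v). f u v)" "p \<in> M" for f and p :: "real ^ 4"
  proof -
    have "(\<lambda>(u, v). f u v) differentiable (at (p $ 1, p $ 2))"
      using that by (intro smooth_on_imp_differentiable[OF _ UV]) (auto simp: UV_def)
    moreover have "(\<lambda>q :: real ^ 4. (q $ 1, q $ 2)) differentiable (at p)"
      by (intro bounded_linear_imp_differentiable bounded_linear_Pair bounded_linear_vec_nth)
    ultimately have "(\<lambda>q. (\<lambda>(u, v). f u v) (q $ 1, q $ 2)) differentiable (at p)"
      by (rule differentiable_compose[where f = "\<lambda>(u, v). f u v"])
    then show ?thesis by simp
  qed
  note X = comp[OF smooth_XZ(1)] and Z = comp[OF smooth_XZ(2)]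
  have Y: "Y1 differentiable (at (p $ 1))" "Y2 differentiable (at (p $ 2))" if "p \<in> M" for p
    using smooth_Y that unfolding Ysets
    by (auto intro!: smooth_on_imp_differentiable open_image_vec_nth[OF domain(1)])
  have S: "\<Sigma> differentiable (at x)" for x
  proof -
    have "(sin has_real_derivative cos x) (at x)" "(sinh has_real_derivative cosh x) (at x)"
      "((\<lambda>_. 1) has_real_derivative 0) (at x)"
      by (auto intro!: derivative_eq_intros)
    then show ?thesis
      using Sigma_cases unfolding real_differentiable_def by blast
  qed
  have smooth: "smooth_on M (\<lambda>p. \<xi> p $ a)" for a
    using smooth_surface_vector[OF domain(1)] smooth_Y unfolding Ysets \<xi>_def by blast
  define LX where "LX p = (\<Sum>a\<in>UNIV. \<xi> p $ a * coord_deriv a (\<lambda>q. X (q $ 1) (q $ 2)) p)" for p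
  define LZ where "LZ p = (\<Sum>a\<in>UNIV. \<xi> p $ a * coord_deriv a (\<lambda>q. Z (q $ 1) (q $ 2)) p)" for p
  define E where "E p \<longleftrightarrow> 2 * C = deriv Y1 (p $ 1) + deriv Y2 (p $ 2) + 2 * LZ p" for p
  \<comment> \<open>Stated for arbitrary \<open>\<psi>\<close>, this yields both the existence
    criterion, with \<open>C + LX\<close> as the only possible divergence, and the formulas for a
    given divergence.\<close>
  have key: "conformal_vector_with_divergence M g \<xi> \<psi> \<longleftrightarrow>
      (\<forall>p\<in>M. \<psi> p = C + LX p \<and> E p \<and> C * p $ 3 * deriv \<Sigma> (p $ 3) = 0)" for \<psi>
  proof -
    have "conformal_vector_with_divergence M g \<xi> \<psi> \<longleftrightarrow>
        (\<forall>p\<in>M. \<forall>a b. lie_metric g \<xi> a b p = 2 * \<psi> p * g p $ a $ b)"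
      unfolding g_def
      by (intro conformal_vector_with_divergence_iff_lie transpose_surface_metric
          invertible_surface_metric differentiable_surface_metric X Z S domain smooth
          smooth_on_imp_differentiable[OF smooth domain(1)])
    also have "\<dots> \<longleftrightarrow> (\<forall>p\<in>M. \<psi> p = C + LX p \<and> E p \<and> C * p $ 3 * deriv \<Sigma> (p $ 3) = 0)"
      unfolding g_def \<xi>_def LX_def LZ_def E_def
      by (intro ball_cong refl lie_metric_surface X Z S Y domain(3))
    finally show ?thesis .
  qed
  have LZ: "LZ p = Y1 (p $ 1) * deriv (\<lambda>u. Z u (p $ 2)) (p $ 1)
      + Y2 (p $ 2) * deriv (\<lambda>v. Z (p $ 1) v) (p $ 2)" for p
    by (simp add: LZ_def \<xi>_def sum_4 surface_vector_def coord_deriv_uv)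
  have E: "(\<forall>p\<in>M. E p) \<longleftrightarrow> (\<forall>(u, v) \<in> UV.
      2 * C = deriv Y1 u + 2 * Y1 u * deriv (\<lambda>u'. Z u' v) u
            + deriv Y2 v + 2 * Y2 v * deriv (\<lambda>v'. Z u v') v)"
    by (simp add: E_def LZ UV_def algebra_simps)
  \<comment> \<open>In the plane case the derivative of \<open>\<Sigma>\<close> is zero and the
    condition is void.\<close>
  have C0: "(\<forall>p\<in>M. C * p $ 3 * deriv \<Sigma> (p $ 3) = 0) \<longleftrightarrow> (\<Sigma> = sin \<or> \<Sigma> = sinh \<longrightarrow> C = 0)"
    using scaling_coefficient_zero[of M \<Sigma> C] domain Sigma_cases by auto
  have "conformal_vector M g \<xi> \<longleftrightarrow> (\<forall>p\<in>M. E p) \<and> (\<forall>p\<in>M. C * p $ 3 * deriv \<Sigma> (p $ 3) = 0)"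
    unfolding conformal_vector_def key by auto
  moreover have "\<psi> p = C + LX p \<and>
      \<psi> p = (\<Sum>a\<in>UNIV.
               coord_deriv a (\<lambda>q. X (q $ 1) (q $ 2) + Z (q $ 1) (q $ 2)) p * \<xi> p $ a)
             + 1/2 * (deriv Y1 (p $ 1) + deriv Y2 (p $ 2))"
    if "conformal_vector_with_divergence M g \<xi> \<psi>" "p \<in> M" for \<psi> p
  proof -
    \<comment> \<open>The second formula differs from \<open>C + LX\<close> by replacing
      \<open>C\<close> with \<open>LZ\<close> plus half the sum of the derivatives of
      \<open>Y1\<close> and \<open>Y2\<close>; \<open>E\<close> says that these agree.\<close>
    have "(\<Sum>a\<in>UNIV. coord_deriv a (\<lambda>q. X (q $ 1) (q $ 2) + Z (q $ 1) (q $ 2)) p * \<xi> p $ a)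
        = LX p + LZ p"
      by (simp add: LX_def LZ_def coord_deriv_add[OF X[OF that(2)] Z[OF that(2)]]
          algebra_simps sum.distrib)
    then show ?thesis
      using that(1)[unfolded key E_def, rule_format, OF that(2)] by (simp add: field_simps)
  qed
  ultimately show ?thesis
    unfolding E C0 LX_def by blast
qed

end
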